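(* Let $\mathcal{R}:\mathbb{R}^V\to\mathbb{R}^V$ be the residual function defined in the context, with $\mathcal{H}$ satisfying (H1), (H2), and at least one of (H3) or (H4). Then there exists a norm on $\mathbb{R}^V$ such that the Euler map $\Phi:\mathbb{R}^V\to\mathbb{R}^V$, $\Phi(u):=u-\rho\,\mathcal{R}(u)$, is a contraction (with respect to this norm) for all $\rho>0$ small enough. As a consequence, the equation $\mathcal{R}(u)=0$ admits a unique solution in $\mathbb{R}^V$.
   Context: Setting. $V$ is a finite index set, $\{x_j\}_{j\in V}$ are nodes which are the vertices of a directed graph; $\mathcal{V}_j\subset V$ is the set of (out-)neighbors of $j$, with $j\notin\mathcal{V}_j$. Put $\mathcal{J}:=\{j\in V:\mathcal{V}_j\neq\emptyset\}$ and $\mathcal{B}:=\{j\in V:\mathcal{V}_j=\emptyset\}$, both assumed non-empty. For $k\in\mathcal{V}_j$, $\Delta x_{jk}>0$ is the distance between $x_j$ and $x_k$. For $u\in\mathbb{R}^V$ and $j\in\mathcal{J}$, $\nabla_G u_j:=\{(u_j-u_k)/\Delta x_{jk}\}_{k\in\mathcal{V}_j}\in\mathbb{R}^{|\mathcal{V}_j|}$. For each $j\in\mathcal{J}$ a numerical Hamiltonian $\mathcal{H}(x_j,\cdot,\cdot):\mathbb{R}\times\mathbb{R}^{|\mathcal{V}_j|}\to\mathbb{R}$ is given; the components of its last variable $p$ are indexed by $k\in\mathcal{V}_j$. Boundary values $\{g_j\}_{j\in\mathcal{B}}$ are given. Residual: for a constant $\lambda_b>0$, $\mathcal{R}(u)_j:=\mathcal{H}(x_j,u_j,\nabla_G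 u_j)$ for $j\in\mathcal{J}$ and $\mathcal{R}(u)_j:=\lambda_b(u_j-g_j)$ for $j\in\mathcal{B}$. Hypotheses. (H1) There are constants $[\mathcal{H}]_u,[\mathcal{H}]_p>0$, independent of $x_j$, such that $|\mathcal{H}(x_j,u,p)-\mathcal{H}(x_j,v,p)|\le[\mathcal{H}]_u|u-v|$ and $|\mathcal{H}(x_j,u,p)-\mathcal{H}(x_j,u,q)|\le[\mathcal{H}]_p\|p-q\|_\infty$ for all $j\in\mathcal{J}$, $u,v\in\mathbb{R}$, $p,q\in\mathbb{R}^{|\mathcal{V}_j|}$. (H2) For all $j\in\mathcal{J}$, $u,v\in\mathbb{R}$, $p,q\in\mathbb{R}^{|\mathcal{V}_j|}$: $p\le q$ componentwise implies $\mathcal{H}(x_j,u,p)\le\mathcal{H}(x_j,u,q)$; and $u\le v$ implies $\mathcal{H}(x_j,u,p)\le\mathcal{H}(x_j,v,p)$. (H3) There is $\lambda>0$ such that for all $j\in\mathcal{J}$, $u,v\in\mathbb{R}$, $p\in\mathbb{R}^{|\mathcal{V}_j|}$: $v\ge u$ implies $\mathcal{H}(x_j,v,p)-\mathcal{H}(x_j,u,p)\ge\lambda(v-u)$. (H4) (i) There is $\underline\alpha>0$ such that for all $j\in\mathcal{J}$, $u\in\mathbb{R}$, $k\in\mathcal{V}_j$: $\frac{\partial\mathcal{H}}{\partial p_k}(x_j,u,p)\ge\underline\alpha$ for a.e. $p\in\mathbb{R}^{|\mathcal{V}_j|}$. (ii) For any $j\in\mathcal{J}$ there are $n\in\mathbb{N}$,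 $(j_1,\dots,j_n)\in\mathcal{J}^n$ and $j_{n+1}\in\mathcal{B}$ with $j_1=j$ and $j_{k+1}\in\mathcal{V}_{j_k}$ for $k=1,\dots,n$. (iii) For any $j,k\in\mathcal{J}$: $j\in\mathcal{V}_k$ if and only if $k\in\mathcal{V}_j$. *)

theory Defs
  imports "HOL-Analysis.Analysis"
begin

text \<open>
  A directed graph on the finite type \<open>'v\<close> is given by its out-neighbour map \<open>nb\<close>.
  The domain of the gradient variable depends on \<open>j\<close>: it consists of the real families
  indexed by \<open>nb j\<close>, represented here by the extensional functions on \<open>nb j\<close>.
  Only the values \<open>H j u p\<close> with \<open>nb j \<noteq> {}\<close> and \<open>p \<in> slopes nb j\<close> matter.
\<close>

definition interior_nodes :: "('v \<Rightarrow> 'v set) \<Rightarrow> 'v set" where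
  "interior_nodes nb = {j. nb j \<noteq> {}}"

definition boundary_nodes :: "('v \<Rightarrow> 'v set) \<Rightarrow> 'v set" where
  "boundary_nodes nb = {j. nb j = {}}"

definition slopes :: "('v \<Rightarrow> 'v set) \<Rightarrow> 'v \<Rightarrow> ('v \<Rightarrow> real) set" where
  "slopes nb j = nb j \<rightarrow>\<^sub>E UNIV"

definition graph_gradient ::
  "('v::finite \<Rightarrow> 'v set) \<Rightarrow> ('v \<Rightarrow> 'v \<Rightarrow> real) \<Rightarrow> real ^ 'v \<Rightarrow> 'v \<Rightarrow> 'v \<Rightarrow> real" where
  "graph_gradient nb dx u j = (\<lambda>k\<in>nb j. (u $ j - u $ k) / dx j k)"

definition residual ::
  "('v::finite \<Rightarrow> 'v set) \<Rightarrow> ('v \<Rightarrow> 'v \<Rightarrow> real) \<Rightarrow> ('v \<Rightarrow> real \<Rightarrow> ('v \<Rightarrow> real) \<Rightarrow> real)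
    \<Rightarrow> real \<Rightarrow> ('v \<Rightarrow> real) \<Rightarrow> real ^ 'v \<Rightarrow> real ^ 'v" where
  "residual nb dx H \<beta> g u =
    (\<chi> j. if j \<in> interior_nodes nb then H j (u $ j) (graph_gradient nb dx u j)
         else \<beta> * (u $ j - g j))"

definition euler_map :: "(real ^ 'v \<Rightarrow> real ^ 'v) \<Rightarrow> real \<Rightarrow> real ^ 'v::finite \<Rightarrow> real ^ 'v" where
  "euler_map R \<rho> u = u - \<rho> *\<^sub>R R u"

text \<open>The maximum norm on \<open>slopes nb j\<close>, for a non-empty finite set \<open>A = nb j\<close>.\<close>

definition max_norm_on :: "'v set \<Rightarrow> ('v \<Rightarrow> real) \<Rightarrow> real" where
  "max_norm_on A p = Max ((\<lambda>k. \<bar>p k\<bar>) ` A)"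

definition lipschitz_hamiltonian ::
  "('v \<Rightarrow> 'v set) \<Rightarrow> ('v \<Rightarrow> real \<Rightarrow> ('v \<Rightarrow> real) \<Rightarrow> real) \<Rightarrow> bool" where
  "lipschitz_hamiltonian nb H \<longleftrightarrow>
    (\<exists>L\<^sub>u>0. \<exists>L\<^sub>p>0. \<forall>j\<in>interior_nodes nb. \<forall>u v. \<forall>p\<in>slopes nb j. \<forall>q\<in>slopes nb j.
       \<bar>H j u p - H j v p\<bar> \<le> L\<^sub>u * \<bar>u - v\<bar> \<and>
       \<bar>H j u p - H j u q\<bar> \<le> L\<^sub>p * max_norm_on (nb j) (\<lambda>k. p k - q k))"

definition monotone_hamiltonian ::
  "('v \<Rightarrow> 'v set) \<Rightarrow> ('v \<Rightarrow> real \<Rightarrow> ('v \<Rightarrow> real) \<Rightarrow> real) \<Rightarrow> bool" where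
  "monotone_hamiltonian nb H \<longleftrightarrow>
    (\<forall>j\<in>interior_nodes nb. \<forall>u v. \<forall>p\<in>slopes nb j. \<forall>q\<in>slopes nb j.
       ((\<forall>k\<in>nb j. p k \<le> q k) \<longrightarrow> H j u p \<le> H j u q) \<and>
       (u \<le> v \<longrightarrow> H j u p \<le> H j v p))"

definition strictly_proper ::
  "('v \<Rightarrow> 'v set) \<Rightarrow> ('v \<Rightarrow> real \<Rightarrow> ('v \<Rightarrow> real) \<Rightarrow> real) \<Rightarrow> bool" where
  "strictly_proper nb H \<longleftrightarrow>
    (\<exists>\<mu>>0. \<forall>j\<in>interior_nodes nb. \<forall>u v. \<forall>p\<in>slopes nb j.
       u \<le> v \<longrightarrow> H j v p - H j u p \<ge> \<mu> * (v - u))"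

text \<open>
  Almost everywhere refers to Lebesgue measure on \<open>slopes nb j\<close>. The partial derivative in
  direction \<open>k\<close> is required to exist at almost every \<open>p\<close>; for a Hamiltonian that is
  Lipschitz in \<open>p\<close> its existence is automatic.
\<close>

definition uniformly_increasing_in_slopes ::
  "('v \<Rightarrow> 'v set) \<Rightarrow> ('v \<Rightarrow> real \<Rightarrow> ('v \<Rightarrow> real) \<Rightarrow> real) \<Rightarrow> bool" where
  "uniformly_increasing_in_slopes nb H \<longleftrightarrow>
    (\<exists>\<alpha>>0. \<forall>j\<in>interior_nodes nb. \<forall>u. \<forall>k\<in>nb j.
       AE p in (\<Pi>\<^sub>M i\<in>nb j. (lborel :: real measure)).
         \<exists>D\<ge>\<alpha>. ((\<lambda>t. H j u (p(k := t))) has_real_derivative D) (at (p k)))"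

definition boundary_reachable :: "('v \<Rightarrow> 'v set) \<Rightarrow> bool" where
  "boundary_reachable nb \<longleftrightarrow>
    (\<forall>j\<in>interior_nodes nb. \<exists>n\<ge>1. \<exists>js :: nat \<Rightarrow> 'v.
       js 1 = j \<and> (\<forall>k\<in>{1..n}. js k \<in> interior_nodes nb \<and> js (k + 1) \<in> nb (js k)) \<and>
       js (n + 1) \<in> boundary_nodes nb)"

definition symmetric_interior :: "('v \<Rightarrow> 'v set) \<Rightarrow> bool" where
  "symmetric_interior nb \<longleftrightarrow>
    (\<forall>j\<in>interior_nodes nb. \<forall>k\<in>interior_nodes nb. j \<in> nb k \<longleftrightarrow> k \<in> nb j)"

definition is_norm :: "('a::real_vector \<Rightarrow> real) \<Rightarrow> bool" where
  "is_norm N \<longleftrightarrow>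
    (\<forall>x. 0 \<le> N x) \<and> (\<forall>x. N x = 0 \<longleftrightarrow> x = 0) \<and>
    (\<forall>c x. N (c *\<^sub>R x) = \<bar>c\<bar> * N x) \<and> (\<forall>x y. N (x + y) \<le> N x + N y)"

definition contraction_wrt :: "('a::real_vector \<Rightarrow> real) \<Rightarrow> ('a \<Rightarrow> 'a) \<Rightarrow> bool" where
  "contraction_wrt N \<Phi> \<longleftrightarrow>
    (\<exists>c. 0 \<le> c \<and> c < 1 \<and> (\<forall>u v. N (\<Phi> u - \<Phi> v) \<le> c * N (u - v)))"

end

theory Submission
  imports Defs
begin

text \<open>
  The proof is a comparison argument in a weighted maximum norm. Raising \<open>u\<close> at one node raises the
  residual there at a bounded rate, and raising it at the other nodes lowers the residual. For small
  \<open>\<rho>\<close> the Euler map is therefore monotone in every component. A monotone map contracts the norm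
  \<open>max |u\<^sub>j| / w\<^sub>j\<close> as soon as it contracts upward shifts by multiples of \<open>w\<close>, and for the Euler map
  this means that shifting \<open>u\<close> by \<open>M w\<close> raises every component of the residual by at least
  \<open>\<theta> M w\<^sub>j\<close> for a fixed \<open>\<theta> > 0\<close> (\<open>euler_map_contraction\<close>). So everything rests on finding such
  weights.

  If the Hamiltonian is increasing in \<open>u\<close> at a uniform rate, constant weights do, since constant shifts do not
  change the slopes (\<open>residual_increment_ge_if_strictly_proper\<close>). If it is uniformly increasing in the
  slopes and every node is connected to the boundary, take \<open>w\<^sub>j = 2 - q ^ d\<^sub>j\<close> with \<open>d\<^sub>j\<close> the distance of the node \<open>j\<close> to the boundary and \<open>q\<close>
  small: the shift then raises the slope towards the boundary by much more than it lowers any other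
  slope at that node (\<open>residual_increment_ge_if_increasing_in_slopes\<close>).

  The second case needs the lower bound on the partial derivatives as a lower bound on increments at
  every point. Almost everywhere information suffices for Lipschitz functions on the line, because a
  Lipschitz function maps null sets to null sets (\<open>lipschitz_AE_positive_derivative_mono\<close>); Fubini
  and the density of sets of full measure carry this over to several slopes
  (\<open>AE_partial_derivative_ge_imp_increment_ge\<close>).

  The solutions of the equation are the fixed points of the Euler map, and the weighted norm is
  equivalent to the Euclidean one, so the Banach fixed point theorem applies.
\<close>

section \<open>Lipschitz functions with a lower bound on the derivative almost everywhere\<close>

text \<open>
  If \<open>f b < f a\<close>, choose a level \<open>y\<close> strictly in between that misses the image of the exceptional
  null set: this is possible because Lipschitz images of null sets are null. At the last point
  where \<open>f\<close> takes the value \<open>y\<close> the function has to descend, but its derivative there is positive.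
\<close>

lemma lipschitz_AE_positive_derivative_mono:
  fixes f :: "real \<Rightarrow> real"
  assumes lip: "\<And>s t. \<bar>f s - f t\<bar> \<le> L * \<bar>s - t\<bar>"
    and der: "AE t in lborel. \<exists>D>0. (f has_real_derivative D) (at t)"
    and ab: "a \<le> b"
  shows "f a \<le> f b"
proof (rule ccontr)
  assume "\<not> f a \<le> f b"
  then have fab: "f b < f a" by simp
  define N where "N = {t. \<not> (\<exists>D>0. (f has_real_derivative D) (at t))}"
  have "AE t in lebesgue. \<exists>D>0. (f has_real_derivative D) (at t)"
    using der by (rule AE_completion)
  then have "negligible N"
    unfolding N_def by (simp add: completion.AE_iff_null_sets negligible_iff_null_sets)
  then have "negligible (f ` N)"
  proof (rule negligible_locally_Lipschitz_image[rotated])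
    fix x show "\<exists>T B. open T \<and> x \<in> T \<and> (\<forall>y\<in>N \<inter> T. norm (f y - f x) \<le> B * norm (y - x))"
      using lip by (intro exI[of _ UNIV] exI[of _ L]) auto
  qed simp
  moreover have "\<not> negligible {f b<..<f a}"
    using negligible_interval(2)[of "f b" "f a"] fab by (simp add: box_real(1))
  ultimately obtain y where y: "f b < y" "y < f a" "y \<notin> f ` N"
    by (meson greaterThanLessThan_iff negligible_subset subsetI)
  have "\<bar>f s - f t\<bar> \<le> max L 0 * \<bar>s - t\<bar>" for s t
    using order_trans[OF lip mult_right_mono[of L "max L 0"]] by simp
  then have "continuous_on UNIV f"
    by (intro lipschitz_on_continuous_on[of "max L 0"] lipschitz_onI) (auto simp: dist_real_def)
  then have cont: "continuous_on A f" for A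
    using continuous_on_subset by blast
  define S where "S = {x \<in> {a..b}. f x = y}"
  have "closed S"
    unfolding S_def by (intro continuous_closed_preimage_constant cont closed_atLeastAtMost)
  moreover have "bdd_above S" unfolding S_def by (auto intro!: bdd_aboveI[of _ b])
  moreover have "S \<noteq> {}"
    using IVT2'[of f b y a] y ab cont unfolding S_def by auto
  ultimately have "Sup S \<in> S" by (intro closed_contains_Sup)
  define c where "c = Sup S"
  have c: "a \<le> c" "c \<le> b" "f c = y" using \<open>Sup S \<in> S\<close> by (auto simp: S_def c_def)
  have "c < b" using c y by (cases "c = b") auto
  have below: "f x < y" if x: "c < x" "x \<le> b" for x
  proof (rule ccontr)
    assume "\<not> f x < y"
    then obtain z where "x \<le> z" "z \<le> b" "f z = y"
      using IVT2'[of f b y x] y(1) x(2) cont by force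
    then have "z \<in> S" using x c by (auto simp: S_def)
    then have "z \<le> c" unfolding c_def using \<open>bdd_above S\<close> by (rule cSup_upper)
    with \<open>x \<le> z\<close> x show False by simp
  qed
  have "c \<notin> N" using y c by blast
  then obtain D where "D > 0" "(f has_real_derivative D) (at c)" by (auto simp: N_def)
  then obtain e where e: "e > 0" "\<And>h. h > 0 \<Longrightarrow> h < e \<Longrightarrow> f c < f (c + h)"
    using DERIV_pos_inc_right by meson
  define h where "h = min (e / 2) (b - c)"
  have "h > 0" "h < e" "c + h \<le> b" using e \<open>c < b\<close> by (auto simp: h_def)
  with e(2)[of h] below[of "c + h"] c show False by auto
qed

lemma lipschitz_AE_derivative_ge_imp_increment_ge:
  fixes f :: "real \<Rightarrow> real"
  assumes lip: "\<And>s t. \<bar>f s - f t\<bar> \<le> L * \<bar>s - t\<bar>"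
    and der: "AE t in lborel. \<exists>D\<ge>\<alpha>. (f has_real_derivative D) (at t)"
    and ab: "a \<le> b"
  shows "\<alpha> * (b - a) \<le> f b - f a"
proof (cases "a = b")
  case False
  (* Tilting f by a slope slightly below \<alpha> leaves a derivative that is positive, not just nonnegative. *)
  have "\<gamma> \<le> (f b - f a) / (b - a)" if "\<gamma> < \<alpha>" for \<gamma>
  proof -
    have "f a - \<gamma> * a \<le> f b - \<gamma> * b"
    proof (rule lipschitz_AE_positive_derivative_mono[OF _ _ ab])
      show "\<bar>f s - \<gamma> * s - (f t - \<gamma> * t)\<bar> \<le> (L + \<bar>\<gamma>\<bar>) * \<bar>s - t\<bar>" for s t
      proof -
        have "\<bar>f s - \<gamma> * s - (f t - \<gamma> * t)\<bar> \<le> \<bar>f s - f t\<bar> + \<bar>\<gamma> * (s - t)\<bar>"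
          by (simp add: algebra_simps)
        also have "\<dots> \<le> L * \<bar>s - t\<bar> + \<bar>\<gamma>\<bar> * \<bar>s - t\<bar>"
          using lip[of s t] by (simp add: abs_mult)
        finally show ?thesis by (simp add: distrib_right)
      qed
      show "AE t in lborel. \<exists>D>0. ((\<lambda>t. f t - \<gamma> * t) has_real_derivative D) (at t)"
        using der
      proof eventually_elim
        case (elim t)
        then obtain D where D: "D \<ge> \<alpha>" "(f has_real_derivative D) (at t)" by blast
        have "((\<lambda>t. f t - \<gamma> * t) has_real_derivative D - \<gamma>) (at t)"
          by (auto intro!: derivative_eq_intros D)
        then show ?case using D that by (intro exI[of _ "D - \<gamma>"]) auto
      qed
    qed
    then show ?thesis using False ab by (simp add: field_simps)
  qed
  then have "\<alpha> \<le> (f b - f a) / (b - a)" by (rule dense_le)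
  then show ?thesis using False ab by (simp add: field_simps)
qed simp

section \<open>Almost every point of a finite product\<close>

lemma AE_PiM_sections:
  assumes "product_sigma_finite M" and I: "finite I" "k \<in> I"
    and ae: "AE p in PiM I M. P p"
  shows "AE x in PiM (I - {k}) M. AE y in M k. P (x(k := y))"
proof -
  interpret product_sigma_finite M by fact
  let ?J = "I - {k}"
  have ins: "insert k ?J = I" using I by blast
  obtain N where N: "{p \<in> space (PiM I M). \<not> P p} \<subseteq> N" "emeasure (PiM I M) N = 0"
    "N \<in> sets (PiM I M)"
    using ae by (rule AE_E)
  have meas: "(\<lambda>(x, y). x(k := y)) \<in> PiM ?J M \<Otimes>\<^sub>M M k \<rightarrow>\<^sub>M PiM I M"
    using measurable_add_dim[of k ?J M] ins by simp
  have ind: "(\<lambda>(x, y). indicator N (x(k := y)) :: ennreal) \<in> borel_measurable (PiM ?J M \<Otimes>\<^sub>M M k)"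
    using measurable_compose[OF meas, of "indicator N" borel] N(3)
    by (simp add: case_prod_unfold borel_measurable_indicator)
  have "0 = (\<integral>\<^sup>+ p. indicator N p \<partial>PiM I M)" using N by simp
  also have "\<dots> = (\<integral>\<^sup>+ x. (\<integral>\<^sup>+ y. indicator N (x(k := y)) \<partial>M k) \<partial>PiM ?J M)"
    using product_nn_integral_insert[of ?J k "indicator N"] I N(3) ins by simp
  finally have "AE x in PiM ?J M. (\<integral>\<^sup>+ y. indicator N (x(k := y)) \<partial>M k) = 0"
    using sigma_finite_measure.borel_measurable_nn_integral[OF sigma_finite_measures ind] by (simp add: nn_integral_0_iff_AE)
  then show ?thesis
    using AE_space
  proof eventually_elim
    case (elim x)
    have upd: "(\<lambda>y. x(k := y)) \<in> M k \<rightarrow>\<^sub>M PiM I M"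
      using measurable_compose[OF measurable_Pair1'[OF elim(2), of "M k"] meas] by simp
    have "(\<lambda>y. indicator N (x(k := y)) :: ennreal) \<in> borel_measurable (M k)"
      using measurable_compose[OF upd, of "indicator N" borel] N(3)
      by (simp add: borel_measurable_indicator)
    with elim(1) have "AE y in M k. (indicator N (x(k := y)) :: ennreal) = 0"
      by (simp add: nn_integral_0_iff_AE)
    then show ?case
      using AE_space
    proof eventually_elim
      case (elim y)
      moreover have "x(k := y) \<in> space (PiM I M)"
        using upd elim(2) by (rule measurable_space)
      ultimately show ?case using N(1) by (auto simp: indicator_def split: if_splits)
    qed
  qed
qed

text \<open>Boxes have positive volume, so they are not contained in a null set.\<close>

lemma AE_PiM_lborel_dense:
  fixes x :: "'i \<Rightarrow> real"
  assumes I: "finite I" and ae: "AE p in PiM I (\<lambda>_. lborel :: real measure). P p"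
    and "\<delta> > 0"
  obtains y where "y \<in> I \<rightarrow>\<^sub>E UNIV" "P y" "\<And>i. i \<in> I \<Longrightarrow> \<bar>x i - y i\<bar> < \<delta>"
proof -
  interpret product_sigma_finite "\<lambda>_ :: 'i. lborel :: real measure" ..
  define B where "B = (\<Pi>\<^sub>E i\<in>I. {x i - \<delta><..<x i + \<delta>})"
  obtain N where N: "{p \<in> space (PiM I (\<lambda>_. lborel)). \<not> P p} \<subseteq> N"
    "emeasure (PiM I (\<lambda>_. lborel :: real measure)) N = 0" "N \<in> sets (PiM I (\<lambda>_. lborel))"
    using ae by (rule AE_E)
  have "emeasure (PiM I (\<lambda>_. lborel)) B = (\<Prod>i\<in>I. ennreal (2 * \<delta>))"
    unfolding B_def using I \<open>\<delta> > 0\<close> by (subst emeasure_PiM) auto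
  also have "\<dots> \<noteq> 0" using I \<open>\<delta> > 0\<close> by simp
  finally have "\<not> B \<subseteq> N"
    using N emeasure_mono[of B N "PiM I (\<lambda>_. lborel)"] by auto
  then obtain y where "y \<in> B" "y \<notin> N" by blast
  moreover have "B \<subseteq> I \<rightarrow>\<^sub>E UNIV" by (auto simp: B_def)
  ultimately have y: "y \<in> I \<rightarrow>\<^sub>E UNIV" by blast
  then have "P y" using N(1) \<open>y \<notin> N\<close> by (simp add: space_PiM subset_iff) blast
  have "\<bar>x i - y i\<bar> < \<delta>" if "i \<in> I" for i
    using PiE_mem[OF \<open>y \<in> B\<close>[unfolded B_def] that] by (auto simp: abs_if)
  with y \<open>P y\<close> show thesis by (rule that)
qed

section \<open>Increments of a Lipschitz function of several slopes\<close>

lemma max_norm_on_le: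
  assumes "finite A" "A \<noteq> {}" "\<And>k. k \<in> A \<Longrightarrow> \<bar>p k\<bar> \<le> r"
  shows "max_norm_on A p \<le> r"
  using assms by (simp add: max_norm_on_def)

text \<open>
  By Fubini, almost every line parallel to the \<open>k\<close>-th axis satisfies the derivative bound at
  almost every one of its points, and there the one-dimensional result applies. Such lines are dense,
  and continuity carries the bound over to all the others.
\<close>

lemma AE_partial_derivative_ge_imp_increment_ge:
  fixes F :: "('i \<Rightarrow> real) \<Rightarrow> real"
  assumes A: "finite A" "k \<in> A" and "0 \<le> L"
    and lip: "\<And>p q. p \<in> A \<rightarrow>\<^sub>E UNIV \<Longrightarrow> q \<in> A \<rightarrow>\<^sub>E UNIV \<Longrightarrow>
      \<bar>F p - F q\<bar> \<le> L * max_norm_on A (\<lambda>i. p i - q i)"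
    and ae: "AE p in PiM A (\<lambda>_. lborel :: real measure).
      \<exists>D\<ge>\<alpha>. ((\<lambda>t. F (p(k := t))) has_real_derivative D) (at (p k))"
    and p: "p \<in> A \<rightarrow>\<^sub>E UNIV" and st: "s \<le> t"
  shows "\<alpha> * (t - s) \<le> F (p(k := t)) - F (p(k := s))"
proof (rule field_le_epsilon)
  have lip': "\<bar>F p - F q\<bar> \<le> L * r"
    if "p \<in> A \<rightarrow>\<^sub>E UNIV" "q \<in> A \<rightarrow>\<^sub>E UNIV" "\<And>i. i \<in> A \<Longrightarrow> \<bar>p i - q i\<bar> \<le> r" for p q r
  proof -
    have "max_norm_on A (\<lambda>i. p i - q i) \<le> r" using A that(3) by (intro max_norm_on_le) auto
    then show ?thesis using lip[OF that(1,2)] \<open>0 \<le> L\<close> by (meson mult_left_mono order_trans)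
  qed
  interpret product_sigma_finite "\<lambda>_ :: 'i. lborel :: real measure" ..
  have "AE x in PiM (A - {k}) (\<lambda>_. lborel :: real measure). AE y in lborel.
      \<exists>D\<ge>\<alpha>. ((\<lambda>t. F (x(k := t))) has_real_derivative D) (at y)"
    using AE_PiM_sections[OF product_sigma_finite_axioms A ae] by simp
  note lines = AE_PiM_lborel_dense[OF _ this]
  fix e :: real assume "e > 0"
  (* Moving p to a good line costs at most L * \<delta> at each of the two ends; the 1 covers L = 0. *)
  define \<delta> where "\<delta> = e / (2 * (L + 1))"
  have \<delta>: "\<delta> > 0" "2 * (L * \<delta>) \<le> e"
    using \<open>e > 0\<close> \<open>0 \<le> L\<close> by (auto simp: \<delta>_def field_simps)
  obtain x where x: "x \<in> (A - {k}) \<rightarrow>\<^sub>E UNIV"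
    "AE y in lborel. \<exists>D\<ge>\<alpha>. ((\<lambda>t. F (x(k := t))) has_real_derivative D) (at y)"
    "\<And>i. i \<in> A - {k} \<Longrightarrow> \<bar>p i - x i\<bar> < \<delta>"
    using lines[OF _ \<delta>(1), of p] A by blast
  have xk: "x(k := y) \<in> A \<rightarrow>\<^sub>E UNIV" for y
    using x(1) A by (auto simp: PiE_iff extensional_def)
  have pk: "p(k := y) \<in> A \<rightarrow>\<^sub>E UNIV" for y
    using p A by (auto simp: PiE_iff extensional_def)
  have "\<alpha> * (t - s) \<le> F (x(k := t)) - F (x(k := s))"
  proof (rule lipschitz_AE_derivative_ge_imp_increment_ge[OF _ x(2) st])
    show "\<bar>F (x(k := a)) - F (x(k := b))\<bar> \<le> L * \<bar>a - b\<bar>" for a b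
      by (rule lip'[OF xk xk]) auto
  qed
  moreover have "\<bar>F (p(k := y)) - F (x(k := y))\<bar> \<le> L * \<delta>" for y
    by (rule lip'[OF pk xk]) (use x(3) \<delta>(1) in \<open>auto intro: less_imp_le\<close>)
  from this[of s] this[of t] \<delta>(2) calculation
  show "\<alpha> * (t - s) \<le> F (p(k := t)) - F (p(k := s)) + e" by linarith
qed

text \<open>
  Raising the slope \<open>k\<close> by \<open>a\<close> contributes at least \<open>\<alpha> * a\<close>, while lowering all the others by at most
  \<open>r\<close> costs at most \<open>L * r\<close>; the two changes are made one after the other.
\<close>

lemma increment_ge_if_one_slope_raised:
  fixes F :: "('i \<Rightarrow> real) \<Rightarrow> real"
  assumes A: "finite A" "k \<in> A" and "0 \<le> L"
    and lip: "\<And>p q. p \<in> A \<rightarrow>\<^sub>E UNIV \<Longrightarrow> q \<in> A \<rightarrow>\<^sub>E UNIV \<Longrightarrow>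
      \<bar>F p - F q\<bar> \<le> L * max_norm_on A (\<lambda>i. p i - q i)"
    and mono: "\<And>p q. p \<in> A \<rightarrow>\<^sub>E UNIV \<Longrightarrow> q \<in> A \<rightarrow>\<^sub>E UNIV \<Longrightarrow> (\<And>i. i \<in> A \<Longrightarrow> p i \<le> q i) \<Longrightarrow> F p \<le> F q"
    and incr: "\<And>p s t. p \<in> A \<rightarrow>\<^sub>E UNIV \<Longrightarrow> s \<le> t \<Longrightarrow>
      \<alpha> * (t - s) \<le> F (p(k := t)) - F (p(k := s))"
    and pq: "p \<in> A \<rightarrow>\<^sub>E UNIV" "q \<in> A \<rightarrow>\<^sub>E UNIV"
    and "0 \<le> a" "p k + a \<le> q k"
    and "0 \<le> r" "\<And>i. i \<in> A \<Longrightarrow> p i - r \<le> q i"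
  shows "\<alpha> * a - L * r \<le> F q - F p"
proof -
  define m where "m = (\<lambda>i\<in>A. if i = k then p k else p i - r)"
  have m: "m \<in> A \<rightarrow>\<^sub>E UNIV" by (auto simp: m_def)
  have mk: "m(k := p k + a) \<in> A \<rightarrow>\<^sub>E UNIV"
    using m A by (auto simp: PiE_iff extensional_def)
  have "m(k := p k) = m" using A by (auto simp: m_def)
  then have "\<alpha> * a \<le> F (m(k := p k + a)) - F m"
    using incr[OF m, of "p k" "p k + a"] \<open>0 \<le> a\<close> by simp
  moreover have "F (m(k := p k + a)) \<le> F q"
    by (rule mono[OF mk pq(2)]) (use assms in \<open>auto simp: m_def\<close>)
  moreover have "max_norm_on A (\<lambda>i. m i - p i) \<le> r"
    by (rule max_norm_on_le) (use A \<open>0 \<le> r\<close> in \<open>auto simp: m_def\<close>)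
  then have "\<bar>F m - F p\<bar> \<le> L * r"
    using lip[OF m pq(1)] \<open>0 \<le> L\<close> by (meson mult_left_mono order_trans)
  ultimately show ?thesis by linarith
qed

section \<open>Contractions in weighted maximum norms\<close>

definition weighted_max_norm :: "('v::finite \<Rightarrow> real) \<Rightarrow> real ^ 'v \<Rightarrow> real" where
  "weighted_max_norm w x = Max (range (\<lambda>j. \<bar>x $ j\<bar> / w j))"

lemma weighted_max_norm_le_iff:
  assumes "\<And>j. 0 < w j"
  shows "weighted_max_norm w x \<le> M \<longleftrightarrow> (\<forall>j. \<bar>x $ j\<bar> \<le> M * w j)"
  using assms by (auto simp: weighted_max_norm_def pos_divide_le_eq)

lemma abs_component_le_weighted_max_norm:
  assumes "\<And>j. 0 < w j"
  shows "\<bar>x $ j\<bar> \<le> weighted_max_norm w x * w j"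
  using weighted_max_norm_le_iff[of w x "weighted_max_norm w x", OF assms] by blast

lemma weighted_max_norm_nonneg:
  assumes "\<And>j. 0 < w j"
  shows "0 \<le> weighted_max_norm w x"
proof -
  fix j :: 'a
  have "0 \<le> weighted_max_norm w x * w j"
    using abs_component_le_weighted_max_norm[of w x j, OF assms] by linarith
  then show ?thesis using assms[of j] by (simp add: zero_le_mult_iff)
qed

lemma is_norm_weighted_max_norm:
  assumes w: "\<And>j. 0 < w j"
  shows "is_norm (weighted_max_norm w)"
proof -
  let ?N = "weighted_max_norm w"
  note le_iff = weighted_max_norm_le_iff[of w, OF w]
  note comp = abs_component_le_weighted_max_norm[of w, OF w]
  note nonneg = weighted_max_norm_nonneg[of w, OF w]
  have zero: "?N x = 0 \<longleftrightarrow> x = 0" for x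
    using le_iff[of x 0] nonneg[of x] by (auto simp: vec_eq_iff)
  have scale_le: "?N (c *\<^sub>R x) \<le> \<bar>c\<bar> * ?N x" for c x
    unfolding le_iff using comp[of x] by (auto simp: abs_mult mult.assoc intro: mult_left_mono)
  have "?N (c *\<^sub>R x) = \<bar>c\<bar> * ?N x" for c x
  proof (cases "c = 0")
    case True
    then show ?thesis using zero[of 0] by simp
  next
    case False
    have "?N x \<le> \<bar>inverse c\<bar> * ?N (c *\<^sub>R x)"
      using scale_le[of "inverse c" "c *\<^sub>R x"] False by simp
    then have "\<bar>c\<bar> * ?N x \<le> ?N (c *\<^sub>R x)"
      using False by (simp add: field_simps)
    with scale_le[of c x] show ?thesis by simp
  qed
  moreover have "?N (x + y) \<le> ?N x + ?N y" for x y
    unfolding le_iff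
  proof
    fix j
    have "\<bar>(x + y) $ j\<bar> \<le> \<bar>x $ j\<bar> + \<bar>y $ j\<bar>" by simp
    also have "\<dots> \<le> ?N x * w j + ?N y * w j" by (intro add_mono comp)
    finally show "\<bar>(x + y) $ j\<bar> \<le> (?N x + ?N y) * w j" by (simp add: distrib_right)
  qed
  ultimately show ?thesis using nonneg zero by (simp add: is_norm_def)
qed

lemma norm_le_weighted_max_norm:
  assumes "\<And>j. 0 < w j"
  shows "norm x \<le> (\<Sum>j\<in>UNIV. w j) * weighted_max_norm w x"
proof -
  have "norm x \<le> (\<Sum>j\<in>UNIV. \<bar>x $ j\<bar>)" by (rule norm_le_l1_cart)
  also have "\<dots> \<le> (\<Sum>j\<in>UNIV. weighted_max_norm w x * w j)"
    by (intro sum_mono abs_component_le_weighted_max_norm assms)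
  finally show ?thesis by (simp add: sum_distrib_right mult.commute)
qed

lemma weighted_max_norm_le_norm:
  fixes w :: "'v::finite \<Rightarrow> real"
  assumes w: "\<And>j. 0 < w j"
  shows "weighted_max_norm w x \<le> (\<Sum>j\<in>UNIV. inverse (w j)) * norm x"
  unfolding weighted_max_norm_le_iff[of w, OF w]
proof
  fix j
  have "inverse (w j) \<le> (\<Sum>j\<in>UNIV. inverse (w j))"
    by (rule member_le_sum) (auto simp: w less_imp_le)
  then have "1 \<le> (\<Sum>j\<in>UNIV. inverse (w j)) * w j"
    using w[of j] by (simp add: field_simps)
  then have "norm x \<le> (\<Sum>j\<in>UNIV. inverse (w j)) * w j * norm x"
    by (metis mult_1 mult_right_mono norm_ge_zero)
  then show "\<bar>x $ j\<bar> \<le> (\<Sum>j\<in>UNIV. inverse (w j)) * norm x * w j"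
    using component_le_norm_cart[of x j] by (simp add: mult_ac)
qed

text \<open>
  Some iterate of \<open>\<Phi>\<close> contracts the original norm as well, because the factors \<open>c ^ m\<close> eventually
  beat the equivalence constants. The unique fixed point of an iterate is the unique fixed point
  of \<open>\<Phi>\<close>, since \<open>\<Phi>\<close> commutes with its iterates and so maps their fixed points to fixed points.
\<close>

lemma contraction_wrt_equivalent_norm_fixpoint:
  fixes \<Phi> :: "'a::banach \<Rightarrow> 'a"
  assumes "contraction_wrt N \<Phi>" and "0 \<le> A"
    and NA: "\<And>x. norm x \<le> A * N x" and NB: "\<And>x. N x \<le> B * norm x"
  shows "\<exists>!u. \<Phi> u = u"
proof -
  obtain c where c: "0 \<le> c" "c < 1" "\<And>u v. N (\<Phi> u - \<Phi> v) \<le> c * N (u - v)"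
    using assms(1) by (auto simp: contraction_wrt_def)
  have iter: "N ((\<Phi> ^^ m) u - (\<Phi> ^^ m) v) \<le> c ^ m * N (u - v)" for m u v
  proof (induction m)
    case (Suc m)
    have "N ((\<Phi> ^^ Suc m) u - (\<Phi> ^^ Suc m) v) \<le> c * N ((\<Phi> ^^ m) u - (\<Phi> ^^ m) v)"
      using c(3) by simp
    also have "\<dots> \<le> c * (c ^ m * N (u - v))" using Suc c(1) by (rule mult_left_mono)
    finally show ?case by simp
  qed simp
  have "(\<lambda>m. A * (c ^ m * B)) \<longlonglongrightarrow> A * (0 * B)"
    using c by (intro tendsto_intros LIMSEQ_realpow_zero)
  then have "\<forall>\<^sub>F m in sequentially. A * (c ^ m * B) < 1 / 2"
    by (rule order_tendstoD) simp
  then obtain m where m: "A * (c ^ m * B) < 1 / 2"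
    using eventually_happens'[OF sequentially_bot] by blast
  have "\<exists>!u. (\<Phi> ^^ m) u = u"
  proof (rule banach_fix_type[of "1 / 2"])
    show "\<forall>u v. dist ((\<Phi> ^^ m) u) ((\<Phi> ^^ m) v) \<le> 1 / 2 * dist u v"
    proof (intro allI)
      fix u v
      have "norm ((\<Phi> ^^ m) u - (\<Phi> ^^ m) v) \<le> A * N ((\<Phi> ^^ m) u - (\<Phi> ^^ m) v)" by (rule NA)
      also have "\<dots> \<le> A * (c ^ m * N (u - v))"
        using iter \<open>0 \<le> A\<close> by (rule mult_left_mono)
      also have "\<dots> \<le> A * (c ^ m * (B * norm (u - v)))"
        using NB c(1) \<open>0 \<le> A\<close> by (intro mult_left_mono) auto
      also have "\<dots> = A * (c ^ m * B) * norm (u - v)" by simp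
      also have "\<dots> \<le> 1 / 2 * norm (u - v)" using m by (intro mult_right_mono) auto
      finally show "dist ((\<Phi> ^^ m) u) ((\<Phi> ^^ m) v) \<le> 1 / 2 * dist u v"
        by (simp add: dist_norm)
    qed
  qed auto
  then obtain u where u: "(\<Phi> ^^ m) u = u" "\<And>v. (\<Phi> ^^ m) v = v \<Longrightarrow> v = u" by blast
  have "(\<Phi> ^^ m) (\<Phi> u) = \<Phi> u" by (metis funpow_swap1 u(1))
  then have "\<Phi> u = u" by (rule u(2))
  moreover have "v = u" if "\<Phi> v = v" for v
    by (rule u(2), induction m) (simp_all add: that)
  ultimately show ?thesis by blast
qed

text \<open>
  With \<open>M\<close> the weighted distance of \<open>u\<close> and \<open>v\<close>, the vector \<open>v + M w\<close> lies above \<open>u\<close>. The Euler map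
  is monotone because of \<open>upper\<close>, so the image of \<open>u\<close> lies below the image of \<open>v + M w\<close>, and \<open>lower\<close>
  says that the latter exceeds the image of \<open>v\<close> by at most \<open>(1 - \<rho> \<theta>) M w\<close>.
\<close>

lemma euler_map_contraction:
  fixes R :: "real ^ 'v::finite \<Rightarrow> real ^ 'v"
  assumes w: "\<And>j. 0 < w j" and "0 < \<theta>"
    and upper: "\<And>u v j. (\<And>i. u $ i \<le> v $ i) \<Longrightarrow> R v $ j - R u $ j \<le> K * (v $ j - u $ j)"
    and lower: "\<And>v M j. 0 \<le> M \<Longrightarrow> \<theta> * (M * w j) \<le> R (v + M *\<^sub>R vec_lambda w) $ j - R v $ j"
    and \<rho>: "0 < \<rho>" "\<rho> * K \<le> 1"
  shows "contraction_wrt (weighted_max_norm w) (euler_map R \<rho>)"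
proof -
  have one_sided: "euler_map R \<rho> u $ j - euler_map R \<rho> v $ j
      \<le> (1 - \<rho> * \<theta>) * weighted_max_norm w (u - v) * w j" for u v j
  proof -
    define M where "M = weighted_max_norm w (u - v)"
    define z where "z = v + M *\<^sub>R vec_lambda w"
    have "0 \<le> M" unfolding M_def by (rule weighted_max_norm_nonneg[OF w])
    have "\<bar>u $ i - v $ i\<bar> \<le> M * w i" for i
      using abs_component_le_weighted_max_norm[of w "u - v" i, OF w] by (simp add: M_def)
    from abs_le_D1[OF this] have uz: "u $ i \<le> z $ i" for i
      by (simp add: z_def algebra_simps)
    have "\<rho> * (R z $ j - R u $ j) \<le> \<rho> * (K * (z $ j - u $ j))"
      using upper[OF uz] \<rho> by (intro mult_left_mono) auto
    also have "\<dots> = (\<rho> * K) * (z $ j - u $ j)" by simp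
    also have "\<dots> \<le> 1 * (z $ j - u $ j)"
      using uz[of j] \<rho> by (intro mult_right_mono) auto
    finally have "u $ j - \<rho> * R u $ j \<le> z $ j - \<rho> * R z $ j" by (simp add: right_diff_distrib)
    moreover have "\<rho> * (\<theta> * (M * w j)) \<le> \<rho> * (R z $ j - R v $ j)"
      unfolding z_def using lower[OF \<open>0 \<le> M\<close>] \<rho> by (intro mult_left_mono) auto
    moreover have "z $ j = v $ j + M * w j" by (simp add: z_def)
    ultimately show ?thesis
      unfolding euler_map_def M_def[symmetric] by (simp add: algebra_simps)
  qed
  (* Both bounds apply to a shift by w; this makes the contraction factor nonnegative. *)
  have "\<theta> \<le> K"
  proof -
    fix j :: 'v
    have "\<theta> * w j \<le> R (vec_lambda w) $ j - R 0 $ j" using lower[of 1 j 0] by simp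
    also have "\<dots> \<le> K * w j" using upper[of 0 "vec_lambda w" j] w by (simp add: less_imp_le)
    finally show ?thesis using w[of j] by simp
  qed
  then have "\<rho> * \<theta> \<le> 1" using \<rho> by (meson less_imp_le mult_left_mono order_trans)
  moreover have "weighted_max_norm w (euler_map R \<rho> u - euler_map R \<rho> v)
      \<le> (1 - \<rho> * \<theta>) * weighted_max_norm w (u - v)" for u v
  proof -
    have "weighted_max_norm w (v - u) = weighted_max_norm w (u - v)"
      by (simp add: weighted_max_norm_def abs_minus_commute)
    then show ?thesis
      unfolding weighted_max_norm_le_iff[of w, OF w]
      using one_sided[of u _ v] one_sided[of v _ u] by (auto simp: abs_le_iff)
  qed
  moreover have "1 - \<rho> * \<theta> < 1" using \<rho> \<open>0 < \<theta>\<close> by simp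
  ultimately show ?thesis
    unfolding contraction_wrt_def by (intro exI[of _ "1 - \<rho> * \<theta>"]) auto
qed

section \<open>The residual\<close>

lemma graph_gradient_in_slopes: "graph_gradient nb dx u j \<in> slopes nb j"
  by (auto simp: graph_gradient_def slopes_def)

lemma edge_length_bounds:
  fixes nb :: "'v::finite \<Rightarrow> 'v set" and dx :: "'v \<Rightarrow> 'v \<Rightarrow> real"
  assumes "\<And>j k. k \<in> nb j \<Longrightarrow> 0 < dx j k"
  obtains l h where "0 < l" "0 < h"
    "\<And>j k. k \<in> nb j \<Longrightarrow> l \<le> dx j k" "\<And>j k. k \<in> nb j \<Longrightarrow> dx j k \<le> h"
proof
  let ?E = "(\<lambda>(j, k). dx j k) ` (SIGMA j:UNIV. nb j)"
  have fin: "finite (insert 1 ?E)" by simp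
  show "0 < Min (insert 1 ?E)" using assms by (subst Min_gr_iff[OF fin]) auto
  show "0 < Max (insert 1 ?E)" by (subst Max_gr_iff[OF fin]) auto
  fix j k assume "k \<in> nb j"
  then have "dx j k \<in> insert 1 ?E" by force
  then show "Min (insert 1 ?E) \<le> dx j k" "dx j k \<le> Max (insert 1 ?E)"
    by (rule Min_le[OF fin], rule Max_ge[OF fin])
qed

text \<open>
  Raising \<open>u\<close> at the other nodes only lowers the slopes at \<open>j\<close>, hence the Hamiltonian. It remains
  to raise \<open>u $ j\<close> alone, which the Lipschitz conditions control.
\<close>

lemma residual_increment_le:
  fixes nb :: "'v::finite \<Rightarrow> 'v set"
  assumes dx: "\<And>j k. k \<in> nb j \<Longrightarrow> dx j k > 0" and "\<beta> > 0"
    and "lipschitz_hamiltonian nb H" and "monotone_hamiltonian nb H"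
  shows "\<exists>K>0. \<forall>u v j. (\<forall>i. u $ i \<le> v $ i) \<longrightarrow>
    residual nb dx H \<beta> g v $ j - residual nb dx H \<beta> g u $ j \<le> K * (v $ j - u $ j)"
proof -
  obtain Lu Lp where L: "0 < Lu" "0 < Lp"
    and lip: "\<forall>j\<in>interior_nodes nb. \<forall>u v. \<forall>p\<in>slopes nb j. \<forall>q\<in>slopes nb j.
       \<bar>H j u p - H j v p\<bar> \<le> Lu * \<bar>u - v\<bar> \<and>
       \<bar>H j u p - H j u q\<bar> \<le> Lp * max_norm_on (nb j) (\<lambda>k. p k - q k)"
    using assms(3) unfolding lipschitz_hamiltonian_def by (elim exE conjE)
  note lip_u = lip[rule_format, THEN conjunct1] and lip_p = lip[rule_format, THEN conjunct2]
  obtain l h where lh: "0 < l" "0 < h"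
    "\<And>j k. k \<in> nb j \<Longrightarrow> l \<le> dx j k" "\<And>j k. k \<in> nb j \<Longrightarrow> dx j k \<le> h"
    by (rule edge_length_bounds[of nb dx, OF dx]) (assumption, rule that)
  note l = lh(1,3)
  (* The summand \<beta> lets the same constant serve the boundary nodes. *)
  define K where "K = Lu + Lp / l + \<beta>"
  show ?thesis
  proof (intro exI[of _ K] conjI allI impI)
    show "0 < K" using L l \<open>\<beta> > 0\<close> by (simp add: K_def add_pos_pos)
  next
    fix u v :: "real ^ 'v" and j
    assume uv: "\<forall>i. u $ i \<le> v $ i"
    let ?d = "v $ j - u $ j"
    have d: "0 \<le> ?d" using uv by simp
    show "residual nb dx H \<beta> g v $ j - residual nb dx H \<beta> g u $ j \<le> K * ?d"
    proof (cases "j \<in> interior_nodes nb")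
      case True
      define m where "m = (\<lambda>k\<in>nb j. (v $ j - u $ k) / dx j k)"
      have m: "m \<in> slopes nb j" by (auto simp: m_def slopes_def)
      note grad = graph_gradient_in_slopes[of nb dx _ j]
      have "H j (v $ j) (graph_gradient nb dx v j) \<le> H j (v $ j) m"
        using assms(4) True m grad uv dx
        unfolding monotone_hamiltonian_def
        by (auto simp: m_def graph_gradient_def divide_right_mono less_imp_le)
      moreover have "H j (v $ j) m - H j (u $ j) m \<le> Lu * ?d"
        using lip_u[OF True m m, of "v $ j" "u $ j"] d by simp
      moreover have "max_norm_on (nb j) (\<lambda>k. m k - graph_gradient nb dx u j k) \<le> ?d / l"
      proof (rule max_norm_on_le)
        show "nb j \<noteq> {}" using True by (simp add: interior_nodes_def)
        fix k assume k: "k \<in> nb j"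
        then have "m k - graph_gradient nb dx u j k = ?d / dx j k"
          by (simp add: m_def graph_gradient_def diff_divide_distrib)
        moreover have "?d / dx j k \<le> ?d / l" "0 \<le> ?d / dx j k"
          using d l(1) l(2)[OF k] dx[OF k] by (auto intro: divide_left_mono)
        ultimately show "\<bar>m k - graph_gradient nb dx u j k\<bar> \<le> ?d / l" by simp
      qed simp
      then have "Lp * max_norm_on (nb j) (\<lambda>k. m k - graph_gradient nb dx u j k) \<le> Lp * (?d / l)"
        using L by (intro mult_left_mono) auto
      then have "H j (u $ j) m - H j (u $ j) (graph_gradient nb dx u j) \<le> Lp * (?d / l)"
        using order_trans[OF abs_ge_self lip_p[OF True m grad, of "u $ j" u]] by linarith
      moreover have "0 \<le> \<beta> * ?d" using d \<open>\<beta> > 0\<close> by simp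
      ultimately have "H j (v $ j) (graph_gradient nb dx v j)
          - H j (u $ j) (graph_gradient nb dx u j) \<le> Lu * ?d + Lp * (?d / l) + \<beta> * ?d" by linarith
      then show ?thesis using True by (simp add: residual_def K_def distrib_right)
    next
      case False
      have "\<beta> * ?d \<le> K * ?d"
        using d L l by (intro mult_right_mono) (auto simp: K_def)
      then show ?thesis using False by (simp add: residual_def right_diff_distrib)
    qed
  qed
qed

text \<open>Adding a constant to \<open>u\<close> does not change the slopes.\<close>

lemma residual_increment_ge_if_strictly_proper:
  fixes nb :: "'v::finite \<Rightarrow> 'v set"
  assumes "\<beta> > 0" "strictly_proper nb H"
  shows "\<exists>\<theta>>0. \<forall>v M j. 0 \<le> M \<longrightarrow> \<theta> * M \<le>
       residual nb dx H \<beta> g (v + M *\<^sub>R (\<chi> i. 1)) $ j - residual nb dx H \<beta> g v $ j"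
proof -
  obtain \<mu> where \<mu>: "\<mu> > 0" "\<forall>j\<in>interior_nodes nb. \<forall>u v. \<forall>p\<in>slopes nb j.
      u \<le> v \<longrightarrow> \<mu> * (v - u) \<le> H j v p - H j u p"
    using assms(2) unfolding strictly_proper_def by (elim exE conjE)
  show ?thesis
  proof (intro exI[of _ "min \<mu> \<beta>"] conjI allI impI)
    show "0 < min \<mu> \<beta>" using \<mu> assms by simp
  next
    fix v :: "real ^ 'v" and M :: real and j
    assume M: "0 \<le> M"
    have "graph_gradient nb dx (v + M *\<^sub>R (\<chi> i. 1)) j = graph_gradient nb dx v j"
      by (simp add: graph_gradient_def)
    moreover have "min \<mu> \<beta> * M \<le> \<mu> * M" "min \<mu> \<beta> * M \<le> \<beta> * M"
      using M by (auto intro: mult_right_mono)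
    ultimately show "min \<mu> \<beta> * M \<le>
        residual nb dx H \<beta> g (v + M *\<^sub>R (\<chi> i. 1)) $ j - residual nb dx H \<beta> g v $ j"
      using \<mu>(2)[rule_format, OF _ graph_gradient_in_slopes[of nb dx v j], of "v $ j" "v $ j + M"] M
      by (auto simp: residual_def algebra_simps)
  qed
qed

text \<open>The length of a shortest path to the boundary drops along the first edge of such a path.\<close>

lemma boundary_reachable_imp_rank:
  fixes nb :: "'v \<Rightarrow> 'v set"
  assumes "boundary_reachable nb"
  shows "\<exists>d :: 'v \<Rightarrow> nat. \<forall>j\<in>interior_nodes nb. \<exists>k\<in>nb j. d k < d j"
proof (intro exI ballI)
  define path where "path n j \<longleftrightarrow> (\<exists>js :: nat \<Rightarrow> 'v. js 0 = j \<and>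
    (\<forall>i<n. js (Suc i) \<in> nb (js i)) \<and> js n \<in> boundary_nodes nb)" for n j
  fix j assume j: "j \<in> interior_nodes nb"
  then obtain n :: nat and js where js: "js 1 = j" "\<forall>k\<in>{1..n}. js (k + 1) \<in> nb (js k)"
    "js (n + 1) \<in> boundary_nodes nb"
    using assms unfolding boundary_reachable_def by meson
  then have "path n j"
    unfolding path_def by (intro exI[of _ "\<lambda>i. js (Suc i)"]) auto
  then have "path (LEAST n. path n j) j" by (rule LeastI)
  then obtain xs where xs: "xs 0 = j" "\<And>i. i < (LEAST n. path n j) \<Longrightarrow> xs (Suc i) \<in> nb (xs i)"
    "xs (LEAST n. path n j) \<in> boundary_nodes nb"
    unfolding path_def by blast
  have "(LEAST n. path n j) \<noteq> 0"
    using xs j by (auto simp: interior_nodes_def boundary_nodes_def)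
  then obtain m where m: "(LEAST n. path n j) = Suc m" by (cases "LEAST n. path n j") auto
  have "path m (xs 1)"
    unfolding path_def by (intro exI[of _ "\<lambda>i. xs (Suc i)"]) (use xs m in auto)
  then have "(LEAST n. path n (xs 1)) < (LEAST n. path n j)"
    using m by (simp add: Least_le less_Suc_eq_le)
  then show "\<exists>k\<in>nb j. (LEAST n. path n k) < (LEAST n. path n j)"
    using xs(1) xs(2)[of 0] m by auto
qed

text \<open>
  The weights \<open>2 - q ^ d j\<close> increase with the rank \<open>d j\<close> in geometrically shrinking steps. From a node
  to a neighbour of smaller rank they drop by at least \<open>q ^ (d j - 1) / 2\<close>, whereas to any other
  neighbour, of whatever rank, they rise by at most \<open>q ^ d j\<close>. For small \<open>q\<close> the increase of the slope
  towards the boundary therefore outweighs the decrease of all the others.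
\<close>

lemma residual_increment_ge_if_increasing_in_slopes:
  fixes nb :: "'v::finite \<Rightarrow> 'v set"
  assumes dx: "\<And>j k. k \<in> nb j \<Longrightarrow> dx j k > 0" and "\<beta> > 0"
    and "lipschitz_hamiltonian nb H" and "monotone_hamiltonian nb H"
    and "uniformly_increasing_in_slopes nb H" and "boundary_reachable nb"
  shows "\<exists>w \<theta>. (\<forall>j. 0 < w j) \<and> 0 < \<theta> \<and> (\<forall>v M j. 0 \<le> M \<longrightarrow> \<theta> * (M * w j) \<le>
    residual nb dx H \<beta> g (v + M *\<^sub>R vec_lambda w) $ j - residual nb dx H \<beta> g v $ j)"
proof -
  obtain L' L where L: "0 < L"
    and lip': "\<forall>j\<in>interior_nodes nb. \<forall>u v. \<forall>p\<in>slopes nb j. \<forall>q\<in>slopes nb j.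
       \<bar>H j u p - H j v p\<bar> \<le> L' * \<bar>u - v\<bar> \<and>
       \<bar>H j u p - H j u q\<bar> \<le> L * max_norm_on (nb j) (\<lambda>k. p k - q k)"
    using assms(3) unfolding lipschitz_hamiltonian_def by (elim exE conjE)
  note lip = lip'[rule_format, THEN conjunct2]
  obtain \<alpha> where \<alpha>: "0 < \<alpha>"
    and deriv: "\<forall>j\<in>interior_nodes nb. \<forall>u. \<forall>k\<in>nb j.
       AE p in (\<Pi>\<^sub>M i\<in>nb j. (lborel :: real measure)).
         \<exists>D\<ge>\<alpha>. ((\<lambda>t. H j u (p(k := t))) has_real_derivative D) (at (p k))"
    using assms(5) unfolding uniformly_increasing_in_slopes_def by (elim exE conjE)
  obtain l h where lh: "0 < l" "0 < h"
    "\<And>j k. k \<in> nb j \<Longrightarrow> l \<le> dx j k" "\<And>j k. k \<in> nb j \<Longrightarrow> dx j k \<le> h"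
    by (rule edge_length_bounds[of nb dx, OF dx]) (assumption, rule that)
  note l = lh(1,3) and h = lh(2,4)
  obtain d :: "'v \<Rightarrow> nat" where d: "\<forall>j\<in>interior_nodes nb. \<exists>k\<in>nb j. d k < d j"
    using boundary_reachable_imp_rank[OF assms(6)] by (elim exE)
  (* This makes the possible loss, at most L * q ^ d j / l per unit of M, no more than half of the
     gain, which is at least \<alpha> * q ^ (d j - 1) / (2 * h). *)
  define q where "q = min (1 / 2) (\<alpha> * l / (4 * h * L))"
  have q: "0 < q" "q \<le> 1 / 2" "L * q / l \<le> \<alpha> / (4 * h)"
  proof -
    show "0 < q" "q \<le> 1 / 2" using \<alpha> l(1) h(1) L by (simp_all add: q_def)
    have "q \<le> \<alpha> * l / (4 * h * L)" by (simp add: q_def)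
    then have "L * q / l \<le> L * (\<alpha> * l / (4 * h * L)) / l"
      using L l(1) by (intro divide_right_mono mult_left_mono) auto
    also have "\<dots> = \<alpha> / (4 * h)" using L l(1) by simp
    finally show "L * q / l \<le> \<alpha> / (4 * h)" .
  qed
  define w where "w j = 2 - q ^ d j" for j
  have w: "1 \<le> w j" "w j \<le> 2" for j
    using q power_le_one[of q "d j"] by (auto simp: w_def)
  define n where "n = Max (range d)"
  have n: "d j \<le> n" for j by (simp add: n_def)
  (* Half of the gain remains, which is \<alpha> * q ^ (d j - 1) / (4 * h); the factor 8 accounts for w \<le> 2. *)
  define \<theta> where "\<theta> = min \<beta> (\<alpha> * q ^ n / (8 * h))"
  have \<theta>: "0 < \<theta>" using \<open>\<beta> > 0\<close> \<alpha> q h by (simp add: \<theta>_def)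
  show ?thesis
  proof (intro exI[of _ w] exI[of _ \<theta>] conjI allI impI)
    show "0 < w j" for j using w(1)[of j] by simp
    show "0 < \<theta>" by (rule \<theta>)
  next
    fix v :: "real ^ 'v" and M :: real and j
    assume M: "0 \<le> M"
    let ?v' = "v + M *\<^sub>R vec_lambda w"
    have Mw: "0 \<le> M * w j" using M w(1)[of j] by simp
    show "\<theta> * (M * w j) \<le> residual nb dx H \<beta> g ?v' $ j - residual nb dx H \<beta> g v $ j"
    proof (cases "j \<in> interior_nodes nb")
      case True
      let ?p = "graph_gradient nb dx v j" and ?p' = "graph_gradient nb dx ?v' j"
      note grad = graph_gradient_in_slopes[of nb dx _ j]
      have p': "?p' k = ?p k + M * (w j - w k) / dx j k" if "k \<in> nb j" for k
        using that by (simp add: graph_gradient_def field_simps flip: add_divide_distrib)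
      obtain k where k: "k \<in> nb j" "d k < d j" using d True by blast
      then obtain m where m: "d j = Suc m" "d k \<le> m" by (cases "d j") auto
      have "\<alpha> * (M * (q ^ m / 2) / h) - L * (M * q ^ d j / l)
          \<le> H j (v $ j) ?p' - H j (v $ j) ?p"
      proof (rule increment_ge_if_one_slope_raised
            [where A = "nb j" and k = k and F = "H j (v $ j)"])
        show "\<bar>H j (v $ j) p - H j (v $ j) q\<bar> \<le> L * max_norm_on (nb j) (\<lambda>i. p i - q i)"
          if "p \<in> nb j \<rightarrow>\<^sub>E UNIV" "q \<in> nb j \<rightarrow>\<^sub>E UNIV" for p q
          using lip[OF True] that by (simp add: slopes_def)
        show "\<alpha> * (t - s) \<le> H j (v $ j) (p(k := t)) - H j (v $ j) (p(k := s))"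
          if "p \<in> nb j \<rightarrow>\<^sub>E UNIV" "s \<le> t" for p s t
          by (rule AE_partial_derivative_ge_imp_increment_ge
            [where L = L, OF _ k(1) _ _ deriv[rule_format, OF True k(1)] that])
              (use L lip[OF True] in \<open>auto simp: slopes_def\<close>)
        show "H j (v $ j) p \<le> H j (v $ j) q"
          if "p \<in> nb j \<rightarrow>\<^sub>E UNIV" "q \<in> nb j \<rightarrow>\<^sub>E UNIV" "\<And>i. i \<in> nb j \<Longrightarrow> p i \<le> q i" for p q
          using assms(4) True that by (simp add: monotone_hamiltonian_def slopes_def)
        show "?p k + M * (q ^ m / 2) / h \<le> ?p' k"
        proof -
          have "q ^ m \<le> q ^ d k" using m q by (intro power_decreasing) auto
          moreover have "q * q ^ m \<le> 1 / 2 * q ^ m" using q by (intro mult_right_mono) auto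
          ultimately have "q ^ m / 2 \<le> w j - w k" using m by (simp add: w_def)
          then have "M * (q ^ m / 2) \<le> M * (w j - w k)" using M by (rule mult_left_mono)
          moreover have "0 \<le> M * (q ^ m / 2)" using M q by simp
          ultimately have "M * (q ^ m / 2) / h \<le> M * (w j - w k) / dx j k"
            using h(2)[OF k(1)] dx[OF k(1)] by (intro frac_le) auto
          then show ?thesis using p'[OF k(1)] by simp
        qed
        show "?p i - M * q ^ d j / l \<le> ?p' i" if i: "i \<in> nb j" for i
        proof -
          have "w i - w j \<le> q ^ d j" using q by (simp add: w_def)
          then have "M * (w i - w j) \<le> M * q ^ d j" using M by (rule mult_left_mono)
          then have "M * (w i - w j) / dx j i \<le> M * q ^ d j / dx j i"
            using dx[OF i] by (simp add: divide_right_mono)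
          also have "\<dots> \<le> M * q ^ d j / l"
            using l i dx[OF i] M q by (intro divide_left_mono) auto
          finally have "- (M * (w j - w i) / dx j i) \<le> M * q ^ d j / l"
            by (simp add: right_diff_distrib diff_divide_distrib)
          then show ?thesis using p'[OF i] by simp
        qed
      qed (use k L M q h l grad in \<open>auto simp: slopes_def\<close>)
      moreover have "L * (M * q ^ d j / l) \<le> \<alpha> * (M * q ^ m) / (4 * h)"
        using mult_right_mono[OF q(3), of "M * q ^ m"] M q by (simp add: m mult_ac)
      moreover have "\<alpha> * (M * (q ^ m / 2) / h) = 2 * (\<alpha> * (M * q ^ m) / (4 * h))" by simp
      ultimately have "\<alpha> * (M * q ^ m) / (4 * h) \<le> H j (v $ j) ?p' - H j (v $ j) ?p" by linarith
      moreover have "v $ j \<le> ?v' $ j" using Mw by simp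
      then have "H j (v $ j) ?p' \<le> H j (?v' $ j) ?p'"
        using assms(4) True grad unfolding monotone_hamiltonian_def by blast
      moreover have "\<theta> * (M * w j) \<le> \<alpha> * (M * q ^ m) / (4 * h)"
      proof -
        have "q ^ n \<le> q ^ m" using m n[of j] q by (intro power_decreasing) auto
        then have "\<alpha> * q ^ n / (8 * h) \<le> \<alpha> * q ^ m / (8 * h)"
          using \<alpha> h by (intro divide_right_mono mult_left_mono) auto
        then have "\<theta> \<le> \<alpha> * q ^ m / (8 * h)" by (simp add: \<theta>_def)
        moreover have "M * w j \<le> M * 2" using M w by (intro mult_left_mono) auto
        ultimately have "\<theta> * (M * w j) \<le> \<alpha> * q ^ m / (8 * h) * (M * 2)"
          by (rule mult_mono) (use \<theta> \<open>\<theta> \<le> _\<close> Mw in linarith)+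
        then show ?thesis by (simp add: mult_ac)
      qed
      ultimately show ?thesis using True by (simp add: residual_def)
    next
      case False
      have "\<theta> * (M * w j) \<le> \<beta> * (M * w j)"
        using Mw by (intro mult_right_mono) (auto simp: \<theta>_def)
      then show ?thesis using False by (simp add: residual_def algebra_simps)
    qed
  qed
qed

section \<open>Contraction and unique solvability\<close>

theorem theorem2:
  fixes nb :: "'v::finite \<Rightarrow> 'v set"
    and dx :: "'v \<Rightarrow> 'v \<Rightarrow> real"
    and H :: "'v \<Rightarrow> real \<Rightarrow> ('v \<Rightarrow> real) \<Rightarrow> real"
    and \<beta> :: real
    and g :: "'v \<Rightarrow> real"
  assumes "\<And>j. j \<notin> nb j"
    and "interior_nodes nb \<noteq> {}"
    and "boundary_nodes nb \<noteq> {}"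
    and "\<And>j k. k \<in> nb j \<Longrightarrow> dx j k > 0"
    and "\<beta> > 0"
    and "lipschitz_hamiltonian nb H"
    and "monotone_hamiltonian nb H"
    and "strictly_proper nb H \<or>
         (uniformly_increasing_in_slopes nb H \<and> boundary_reachable nb \<and> symmetric_interior nb)"
  shows "(\<exists>N. is_norm N \<and>
            (\<exists>\<rho>\<^sub>0>0. \<forall>\<rho>. 0 < \<rho> \<and> \<rho> < \<rho>\<^sub>0 \<longrightarrow>
               contraction_wrt N (euler_map (residual nb dx H \<beta> g) \<rho>))) \<and>
         (\<exists>!u. residual nb dx H \<beta> g u = 0)"
proof -
  let ?R = "residual nb dx H \<beta> g"
  have "\<exists>K>0. \<forall>u v j. (\<forall>i. u $ i \<le> v $ i) \<longrightarrow> ?R v $ j - ?R u $ j \<le> K * (v $ j - u $ j)"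
    using assms(4-7) by (rule residual_increment_le)
  then obtain K where K: "0 < K"
    "\<forall>u v j. (\<forall>i. u $ i \<le> v $ i) \<longrightarrow> ?R v $ j - ?R u $ j \<le> K * (v $ j - u $ j)"
    by (elim exE conjE)
  have "\<exists>w \<theta>. (\<forall>j. 0 < w j) \<and> 0 < \<theta> \<and>
      (\<forall>v M j. 0 \<le> M \<longrightarrow> \<theta> * (M * w j) \<le> ?R (v + M *\<^sub>R vec_lambda w) $ j - ?R v $ j)"
  proof (cases "strictly_proper nb H")
    case True
    then obtain \<theta> where "0 < \<theta>"
      "\<forall>v M j. 0 \<le> M \<longrightarrow> \<theta> * M \<le> ?R (v + M *\<^sub>R (\<chi> i. 1)) $ j - ?R v $ j"
      using residual_increment_ge_if_strictly_proper[OF assms(5), where dx = dx and g = g] by blast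
    then show ?thesis by (intro exI[of _ "\<lambda>_. 1"] exI[of _ \<theta>]) simp
  next
    case False
    with assms(8) have "uniformly_increasing_in_slopes nb H" "boundary_reachable nb" by auto
    with assms(4-7) show ?thesis by (intro residual_increment_ge_if_increasing_in_slopes)
  qed
  then obtain w \<theta> where w: "\<And>j. 0 < w j" and \<theta>: "0 < \<theta>"
    and lower: "\<And>v M j. 0 \<le> M \<Longrightarrow> \<theta> * (M * w j) \<le> ?R (v + M *\<^sub>R vec_lambda w) $ j - ?R v $ j"
    by blast
  have contr: "contraction_wrt (weighted_max_norm w) (euler_map ?R \<rho>)"
    if "0 < \<rho>" "\<rho> * K \<le> 1" for \<rho>
    using euler_map_contraction[OF w \<theta> K(2)[rule_format] lower that] .
  have "\<exists>!u. euler_map ?R (1 / K) u = u"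
  proof (rule contraction_wrt_equivalent_norm_fixpoint)
    show "contraction_wrt (weighted_max_norm w) (euler_map ?R (1 / K))"
      using K(1) by (intro contr) auto
    show "0 \<le> (\<Sum>j\<in>UNIV. w j)" by (intro sum_nonneg less_imp_le w)
  qed (rule norm_le_weighted_max_norm[OF w] weighted_max_norm_le_norm[OF w])+
  then have "\<exists>!u. ?R u = 0"
    using K(1) by (simp add: euler_map_def)
  moreover have "contraction_wrt (weighted_max_norm w) (euler_map ?R \<rho>)"
    if "0 < \<rho>" "\<rho> < 1 / K" for \<rho>
    using that K(1) by (intro contr) (auto simp: field_simps)
  moreover have "is_norm (weighted_max_norm w)" by (rule is_norm_weighted_max_norm[OF w])
  moreover have "0 < 1 / K" using K(1) by simp
  ultimately show ?thesis by blast
qed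

end
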